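(* Let $p_k$ be the model returned by either the CP-$k$ algorithm or the smooth-CP-$k$ algorithm when input with a model $p\in\mathcal M$, a cover $\mathcal V$ for a function $\mathrm{safe}:\mathcal C\to\mathcal M$, and a threshold $k\ge 0$. For a prompt $x$, let $\nu_k(x)$ be the probability that the sampled $y$ is accepted in a single iteration of the while loop. Then: (1) (Near access-freeness) $p_k$ is $\widetilde k_x$-NAF on prompt $x$ with respect to $\mathrm{safe}$ and $\Delta=\Delta_{\max}$, where \[ \widetilde k_x\le k+\log\bigl(1/\nu_k(x)\bigr). \] (2) (Model degradation) $p_k$ satisfies the bound \[ \mathsf{TV}\bigl(p_k(\cdot|x),p(\cdot|x)\bigr)\le 1-\nu_k(x). \] (3) (Oracle complexity) Sampling $y\sim p_k(\cdot|x)$ requires $O(1/\nu_k(x))$ iterations, where each iteration involves obtaining one sample from $p$ and doing $|\mathcal V|+1$ probability computations from either $p$ or $q\in\mathcal V$.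
   Context: $\mathcal X$ is a set of prompts and $\mathcal Y$ a set of outputs. A conditional generative model $p$ takes a prompt $x\in\mathcal X$ and outputs $y\in\mathcal Y$ with probability $p(y|x)$; $\mathcal M$ is the space of such models. $\mathcal C$ is a set of datapoints (pieces of copyrighted material). All logarithms are base 2. For distributions $\rho,\mu$ on $\mathcal Y$, $\mathsf{TV}(\rho,\mu)=\frac12\sum_y|\rho(y)-\mu(y)|$ and $\Delta_{\max}(\rho\|\mu)=\max_{y\in\mathrm{Supp}(\rho)}\log\frac{\rho(y)}{\mu(y)}$. Given a function $\mathrm{safe}:\mathcal C\to\mathcal M$, with $\mathrm{safe}(C)$ also written $\mathrm{safe}_C$, and a divergence measure $\Delta$ between distributions, a model $p$ is $k_x$-near access-free ($k_x$-NAF) on prompt $x\in\mathcal X$ with respect to $\mathcal C$, $\mathrm{safe}$ and $\Delta$ if $\Delta\bigl(p(\cdot|x)\,\|\,\mathrm{safe}_C(\cdot|x)\bigr)\le k_x$ for every $C\in\mathcal C$; the dependence on $\mathcal C$ is dropped when clear. A set $\mathcal V=\{q_1,\dots,q_n\}$ of models is a cover of $\mathrm{safe}$ if for every $C\in\mathcal C$ there exists some $q\in\mathcal V$ with $\mathrm{safe}(C)=q$. Both algorithms take as input a model $p$, a cover $\mathcal V$ of $\mathrm{safe}$, and a threshold $k\ge0$, and return the model $p_k$ specified, on prompt $x$, by the following while loop: repeatedly sample $y\sim p(\cdot|x)$ (the attempts are i.i.d.) until a sample is accepted, and output the accepted sample. - CP-$k$: accept $y$ if $\log\bigl(p(y|x)/q(y|x)\bigr)\le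 k$ for all $q\in\mathcal V$. - smooth-CP-$k$: accept (return) $y$ with probability $\min\left\{1,\min_{q\in\mathcal V}\left\{\frac{2^kq(y|x)}{p(y|x)}\right\}\right\}$. The algorithms assume access to an oracle with which one can both compute conditional probabilities and obtain samples under the models $p$ and $q\in\mathcal V$. *)

theory Defs
  imports "HOL-Probability.Probability"
begin

type_synonym ('x, 'y) model = "'x \<Rightarrow> 'y pmf"

text \<open>
  The value of \<open>log 2 (a / b)\<close> for \<open>a, b \<ge> 0\<close> in the extended reals.  The case \<open>b = 0\<close>, \<open>a > 0\<close>
  has to be \<open>\<infinity>\<close>; with real division one would get \<open>log 2 0 = 0\<close>.  The case \<open>a = b = 0\<close> is
  never used.
\<close>
definition log2_ratio :: "real \<Rightarrow> real \<Rightarrow> ereal" where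
  "log2_ratio a b = (if b = 0 then \<infinity> else if a = 0 then - \<infinity> else ereal (log 2 (a / b)))"

definition TV :: "'y pmf \<Rightarrow> 'y pmf \<Rightarrow> real" where
  "TV \<rho> \<mu> = (1 / 2) * (\<Sum>\<^sub>\<infinity>y. \<bar>pmf \<rho> y - pmf \<mu> y\<bar>)"

text \<open>A supremum in the extended reals, since the support may be infinite.\<close>
definition Delta_max :: "'y pmf \<Rightarrow> 'y pmf \<Rightarrow> ereal" where
  "Delta_max \<rho> \<mu> = (SUP y\<in>set_pmf \<rho>. log2_ratio (pmf \<rho> y) (pmf \<mu> y))"

definition near_access_free ::
  "'c set \<Rightarrow> ('c \<Rightarrow> ('x, 'y) model) \<Rightarrow> ('y pmf \<Rightarrow> 'y pmf \<Rightarrow> ereal) \<Rightarrow> ereal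
   \<Rightarrow> ('x, 'y) model \<Rightarrow> 'x \<Rightarrow> bool"
where
  "near_access_free \<C> safe \<Delta> kx p x \<longleftrightarrow> (\<forall>C\<in>\<C>. \<Delta> (p x) (safe C x) \<le> kx)"

definition is_cover :: "('x, 'y) model set \<Rightarrow> 'c set \<Rightarrow> ('c \<Rightarrow> ('x, 'y) model) \<Rightarrow> bool" where
  "is_cover V \<C> safe \<longleftrightarrow> finite V \<and> (\<forall>C\<in>\<C>. \<exists>q\<in>V. safe C = q)"

text \<open>
  Randomised computations that record the oracle queries they make.  The only queries are to draw
  a sample from a model, and to compute the probability of one output under a model.
\<close>
datatype ('m, 'y) query = is_sample: Sample_Query (queried: 'm) | is_prob: Prob_Query (queried: 'm) 'y

type_synonym ('m, 'y, 'a) oracle_comp = "('a \<times> ('m, 'y) query list) pmf"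

definition pure_comp :: "'a pmf \<Rightarrow> ('m, 'y, 'a) oracle_comp" where
  "pure_comp P = map_pmf (\<lambda>a. (a, [])) P"

definition bind_comp ::
  "('m, 'y, 'a) oracle_comp \<Rightarrow> ('a \<Rightarrow> ('m, 'y, 'b) oracle_comp) \<Rightarrow> ('m, 'y, 'b) oracle_comp"
where
  "bind_comp m f = bind_pmf m (\<lambda>(a, l). map_pmf (\<lambda>(b, l'). (b, l @ l')) (f a))"

definition sample_oracle :: "'x \<Rightarrow> ('x, 'y) model \<Rightarrow> (('x, 'y) model, 'y, 'y) oracle_comp" where
  "sample_oracle x p = map_pmf (\<lambda>y. (y, [Sample_Query p])) (p x)"

definition prob_oracle :: "'x \<Rightarrow> ('x, 'y) model \<Rightarrow> 'y \<Rightarrow> (('x, 'y) model, 'y, real) oracle_comp" where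
  "prob_oracle x p y = return_pmf (pmf (p x) y, [Prob_Query p y])"

primrec prob_oracles ::
  "'x \<Rightarrow> ('x, 'y) model list \<Rightarrow> 'y \<Rightarrow> (('x, 'y) model, 'y, real list) oracle_comp"
where
  "prob_oracles x [] y = pure_comp (return_pmf [])"
| "prob_oracles x (q # qs) y =
     bind_comp (prob_oracle x q y) (\<lambda>b.
     bind_comp (prob_oracles x qs y) (\<lambda>bs.
     pure_comp (return_pmf (b # bs))))"

text \<open>
  The two acceptance rules, as randomised decisions that see the threshold \<open>k\<close>, the number
  \<open>a = p(y|x) > 0\<close>, and the list \<open>bs\<close> of the numbers \<open>q(y|x)\<close> for the models \<open>q\<close> of the cover.
  In the second rule, inserting \<open>1\<close> into the set is the outer minimum with \<open>1\<close>.
\<close>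
definition cp_rule :: "real \<Rightarrow> real \<Rightarrow> real list \<Rightarrow> bool pmf" where
  "cp_rule k a bs = return_pmf (\<forall>b\<in>set bs. log2_ratio a b \<le> ereal k)"

definition smooth_cp_rule :: "real \<Rightarrow> real \<Rightarrow> real list \<Rightarrow> bool pmf" where
  "smooth_cp_rule k a bs = bernoulli_pmf (Min (insert 1 ((\<lambda>b. 2 powr k * b / a) ` set bs)))"

text \<open>
  One iteration of the while loop: \<open>Some y\<close> if the sample \<open>y\<close> is accepted, \<open>None\<close> if it is rejected.
  The list \<open>qs\<close> enumerates the cover.
\<close>
definition iteration ::
  "(real \<Rightarrow> real \<Rightarrow> real list \<Rightarrow> bool pmf) \<Rightarrow> ('x, 'y) model \<Rightarrow> ('x, 'y) model list \<Rightarrow> real \<Rightarrow> 'x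
   \<Rightarrow> (('x, 'y) model, 'y, 'y option) oracle_comp"
where
  "iteration rule p qs k x =
     bind_comp (sample_oracle x p) (\<lambda>y.
     bind_comp (prob_oracle x p y) (\<lambda>a.
     bind_comp (prob_oracles x qs y) (\<lambda>bs.
     bind_comp (pure_comp (rule k a bs)) (\<lambda>accepted.
     pure_comp (return_pmf (if accepted then Some y else None))))))"

definition acceptance_prob ::
  "(real \<Rightarrow> real \<Rightarrow> real list \<Rightarrow> bool pmf) \<Rightarrow> ('x, 'y) model \<Rightarrow> ('x, 'y) model list \<Rightarrow> real \<Rightarrow> 'x \<Rightarrow> real"
where
  "acceptance_prob rule p qs k x =
     measure_pmf.prob (iteration rule p qs k x) {(r, l). r \<noteq> None}"

text \<open>
  The loop repeats \<open>body\<close> until it accepts, and returns the accepted output with the number of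
  iterations executed; \<open>n\<close> counts the iterations before the current one.  The mass of
  \<^const>\<open>None\<close> in the resulting subprobability distribution is the probability of nontermination.
\<close>
partial_function (spmf) repeat_until :: "'y option pmf \<Rightarrow> nat \<Rightarrow> ('y \<times> nat) spmf" where
  "repeat_until body n =
     bind_spmf (spmf_of_pmf body) (\<lambda>r.
       case r of Some y \<Rightarrow> return_spmf (y, Suc n) | None \<Rightarrow> repeat_until body (Suc n))"

definition run ::
  "(real \<Rightarrow> real \<Rightarrow> real list \<Rightarrow> bool pmf) \<Rightarrow> ('x, 'y) model \<Rightarrow> ('x, 'y) model list \<Rightarrow> real \<Rightarrow> 'x
   \<Rightarrow> ('y \<times> nat) spmf"
where
  "run rule p qs k x = repeat_until (map_pmf fst (iteration rule p qs k x)) 0"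

text \<open>
  The returned model \<open>p\<^sub>k\<close>: the law of the output of the loop.  If the acceptance probability at \<open>x\<close>
  is positive, the loop terminates almost surely and the outcome \<^const>\<open>None\<close>, on which
  \<^const>\<open>the\<close> is unspecified, has probability \<open>0\<close>.
\<close>
definition returned_model ::
  "(real \<Rightarrow> real \<Rightarrow> real list \<Rightarrow> bool pmf) \<Rightarrow> ('x, 'y) model \<Rightarrow> ('x, 'y) model list \<Rightarrow> real
   \<Rightarrow> ('x, 'y) model"
where
  "returned_model rule p qs k x = map_pmf the (map_spmf fst (run rule p qs k x))"

text \<open>A nonterminating run counts as infinitely many iterations.\<close>
definition expected_iterations ::
  "(real \<Rightarrow> real \<Rightarrow> real list \<Rightarrow> bool pmf) \<Rightarrow> ('x, 'y) model \<Rightarrow> ('x, 'y) model list \<Rightarrow> real \<Rightarrow> 'x \<Rightarrow> ennreal"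
where
  "expected_iterations rule p qs k x =
     (\<integral>\<^sup>+ r. (case r of None \<Rightarrow> \<infinity> | Some (y, n) \<Rightarrow> of_nat n) \<partial>measure_pmf (run rule p qs k x))"

end

theory Submission
  imports Defs
begin

text \<open>
  The loop repeats i.i.d. iterations, each accepting \<open>y\<close> with some subprobability \<open>\<beta>(y) \<le> p(y|x)\<close>
  of total mass \<open>\<nu>\<close>; hence its output has law \<open>\<beta> / \<nu>\<close>, independent of the number of iterations,
  which is geometric with mean \<open>1 / \<nu>\<close>.  Both rules enforce \<open>\<beta>(y) \<le> 2\<^sup>k q(y|x)\<close>, and dividing by
  \<open>\<nu>\<close> gives the bound on the divergence.  Since \<open>\<beta>\<close> lies below both \<open>p(\<cdot>|x)\<close> and \<open>\<beta> / \<nu>\<close>,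
  these share mass \<open>\<nu>\<close>, so their total variation distance is at most \<open>1 - \<nu>\<close>.
\<close>

section \<open>Law of the rejection loop: output and iteration count\<close>

lemma spmf_bind_case_option:
  "spmf (bind_spmf (spmf_of_pmf B) (\<lambda>r. case r of Some y \<Rightarrow> return_spmf (y, m) | None \<Rightarrow> R)) (z, j) =
     pmf B None * spmf R (z, j) + (if j = m then spmf B z else 0)"
proof -
  have "spmf (bind_spmf (spmf_of_pmf B) (\<lambda>r. case r of Some y \<Rightarrow> return_spmf (y, m) | None \<Rightarrow> R)) (z, j)
      = (\<integral>r. spmf (case r of Some y \<Rightarrow> return_spmf (y, m) | None \<Rightarrow> R) (z, j) \<partial>measure_pmf B)"
    by (simp add: bind_spmf_of_pmf pmf_bind)
  also have "\<dots> = (\<Sum>r\<in>{None, Some z}.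
      spmf (case r of Some y \<Rightarrow> return_spmf (y, m) | None \<Rightarrow> R) (z, j) * pmf B r)"
    by (rule integral_measure_pmf_real) (auto split: option.splits if_splits split_indicator_asm)
  finally show ?thesis by (auto simp: mult.commute)
qed

lemma spmf_repeat_until:
  "spmf (repeat_until B n) (y, m) =
     pmf B None * spmf (repeat_until B (Suc n)) (y, m) + (if m = Suc n then spmf B y else 0)"
  by (subst repeat_until.simps) (rule spmf_bind_case_option)

text \<open>The law of \<open>B\<close> conditioned on not being \<open>None\<close>. For positive
  weight the rescaled spmf is lossless, so \<open>the\<close> never meets
  \<open>None\<close>.\<close>

definition accepted :: "'a spmf \<Rightarrow> 'a pmf" where
  "accepted B = map_pmf the (scale_spmf (1 / weight_spmf B) B)"

lemma pmf_accepted: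
  assumes "weight_spmf B > 0"
  shows "pmf (accepted B) y = spmf B y / weight_spmf B"
proof -
  let ?L = "scale_spmf (1 / weight_spmf B) B"
  have "lossless_spmf ?L" using assms by (simp add: lossless_spmf_def weight_scale_spmf)
  then obtain Q where Q: "?L = spmf_of_pmf Q" by (auto simp: lossless_spmf_conv_spmf_of_pmf)
  then have "accepted B = Q" by (simp add: accepted_def spmf_of_pmf_def pmf.map_comp o_def)
  then have "pmf (accepted B) y = spmf ?L y" by (simp add: Q)
  then show ?thesis using assms by (simp add: spmf_scale_spmf inverse_eq_divide)
qed

text \<open>With weight \<open>w\<close>, rejecting \<open>j\<close> times and then accepting
  \<open>y\<close> has mass \<open>(1 - w) ^ j * spmf B y\<close>, which factors as
  \<open>(spmf B y / w) * ((1 - w) ^ j * w)\<close>; hence the independent pair.\<close>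

lemma repeat_until_eq_geometric:
  assumes pos: "weight_spmf B > 0"
  shows "repeat_until B 0 =
    spmf_of_pmf (pair_pmf (accepted B) (map_pmf Suc (geometric_pmf (weight_spmf B))))"
proof (rule spmf_eqI)
  fix z :: "'a \<times> nat"
  obtain y m where z: "z = (y, m)" by (cases z)
  let ?r = "pmf B None"
  let ?s = "\<lambda>n. spmf (repeat_until B n) (y, m)"
  have r: "0 \<le> ?r" "?r < 1" using pos by (simp_all add: pmf_None_eq_weight_spmf weight_spmf_le_1)
  \<comment> \<open>The loop is only a least fixed point, but its unfolding equation determines \<open>?s\<close>,
    since unfolding \<open>j\<close> times contributes a factor \<open>?r ^ j\<close>, which tends to \<open>0\<close>.\<close>
  have late: "?s n = 0" if "m \<le> n" for n
  proof -
    \<comment> \<open>As \<open>m \<le> n\<close>, the count \<open>Suc (n + j)\<close> never equals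
      \<open>m\<close>, so only the rejection term of the unfolding survives.\<close>
    have iter: "?s n = ?r ^ j * ?s (n + j)" for j
    proof (induction j)
      case (Suc j)
      with that show ?case using spmf_repeat_until[of B "n + j" y m] by simp
    qed simp
    have "(\<lambda>j. ?r ^ j) \<longlonglongrightarrow> 0" using r by (intro LIMSEQ_realpow_zero) auto
    moreover have "?s n \<le> ?r ^ j" for j
      unfolding iter[of j] using r by (intro mult_left_le pmf_le_1) auto
    ultimately have "?s n \<le> 0" by (intro LIMSEQ_le_const) auto
    then show ?thesis by (simp add: order_antisym)
  qed
  \<comment> \<open>After \<open>j\<close> rejections the next acceptance reports exactly
    \<open>m\<close>; continuing past it adds nothing, by \<open>late\<close>.\<close>
  have early: "?s n = ?r ^ j * spmf B y" if "m = Suc (n + j)" for n j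
    using that
  proof (induction j arbitrary: n)
    case 0
    then show ?case using spmf_repeat_until[of B n y m] late[of "Suc n"] by simp
  next
    case (Suc j)
    then show ?case using spmf_repeat_until[of B n y m] by simp
  qed
  have w: "1 - weight_spmf B = ?r" by (simp add: pmf_None_eq_weight_spmf)
  show "spmf (repeat_until B 0) z = spmf (spmf_of_pmf (pair_pmf (accepted B)
      (map_pmf Suc (geometric_pmf (weight_spmf B))))) z"
  proof (cases m)
    case 0
    have "pmf (map_pmf Suc (geometric_pmf (weight_spmf B))) 0 = 0"
      by (auto simp: pmf_eq_0_set_pmf)
    then show ?thesis using 0 late[of 0] by (simp add: z pmf_pair)
  next
    case (Suc j)
    then show ?thesis using early[of 0 j] pos
      by (simp add: z pmf_pair pmf_map_inj' pmf_accepted w pmf_geometric weight_spmf_le_1)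
  qed
qed

text \<open>\<open>geometric_pmf\<close> counts failures and has mean \<open>(1 - w) / w\<close>;
  the \<open>Suc\<close> adds the accepting iteration.\<close>

lemma nn_integral_Suc_geometric_pmf:
  assumes "0 < w" "w \<le> 1"
  shows "(\<integral>\<^sup>+ n. of_nat (Suc n) \<partial>measure_pmf (geometric_pmf w)) = ennreal (1 / w)"
proof -
  have w: "w \<in> {0<..1}" using assms by simp
  have "(\<integral>\<^sup>+ n. of_nat (Suc n) \<partial>measure_pmf (geometric_pmf w)) =
      (\<integral>\<^sup>+ n. ennreal (real n + 1) \<partial>measure_pmf (geometric_pmf w))"
    by (intro nn_integral_cong) (simp add: ennreal_of_nat_eq_real_of_nat add.commute)
  also have "\<dots> = ennreal (\<integral>n. real n + 1 \<partial>measure_pmf (geometric_pmf w))"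
    using integrable_real_geometric_pmf[OF w] by (intro nn_integral_eq_integral) auto
  also have "(\<integral>n. real n + 1 \<partial>measure_pmf (geometric_pmf w)) = 1 / w"
    using integrable_real_geometric_pmf[OF w] expectation_geometric_pmf[OF w] assms
    by (simp add: field_simps)
  finally show ?thesis .
qed

section \<open>Total variation from shared mass\<close>

lemma has_sum_pmf: "(pmf p has_sum measure_pmf.prob p A) A"
proof -
  have "Infinite_Set_Sum.abs_summable_on (pmf p) A" by (rule pmf_abs_summable)
  then have "(pmf p) summable_on A" "infsum (pmf p) A = measure_pmf.prob p A"
    by (simp_all add: abs_summable_equivalent[symmetric] abs_summable_summable
        infsetsum_infsum measure_pmf_conv_infsetsum)
  then show ?thesis by (simp add: has_sum_iff)
qed

lemma has_sum_spmf: "(spmf B has_sum weight_spmf B) UNIV"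
proof -
  have "measure_pmf.prob B (range Some) = weight_spmf B"
    by (simp add: space_measure_spmf measure_measure_spmf_conv_measure_pmf)
  with has_sum_pmf[of B "range Some"] show ?thesis
    by (simp add: has_sum_reindex o_def)
qed

text \<open>Pointwise, \<open>c \<le> a\<close> and \<open>c \<le> b\<close> give
  \<open>\<bar>a - b\<bar> \<le> a + b - 2 * c\<close>; summing over the outputs yields twice the
  bound.\<close>

lemma TV_le_of_common_spmf:
  assumes "\<And>y. spmf B y \<le> pmf \<rho> y" "\<And>y. spmf B y \<le> pmf \<mu> y"
  shows "TV \<rho> \<mu> \<le> 1 - weight_spmf B"
proof -
  let ?g = "\<lambda>y. pmf \<rho> y + pmf \<mu> y + (- 2) * spmf B y"
  have g: "(?g has_sum (1 + 1 + (- 2) * weight_spmf B)) UNIV"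
    by (intro has_sum_add has_sum_cmult_right has_sum_spmf)
       (use has_sum_pmf[of _ UNIV] in auto)
  have le: "\<bar>pmf \<rho> y - pmf \<mu> y\<bar> \<le> ?g y" for y using assms[of y] by linarith
  have "(\<lambda>y. \<bar>pmf \<rho> y - pmf \<mu> y\<bar>) summable_on UNIV"
    by (rule summable_on_comparison_test[where f = ?g]) (use g le in \<open>auto simp: summable_on_def\<close>)
  then have "(\<Sum>\<^sub>\<infinity>y. \<bar>pmf \<rho> y - pmf \<mu> y\<bar>) \<le> 1 + 1 + (- 2) * weight_spmf B"
    using g le by (metis (no_types, lifting) has_sum_iff infsum_mono)
  then show ?thesis by (simp add: TV_def)
qed

section \<open>A single iteration and its acceptance rule\<close>

lemma prob_oracles_eq:
  "prob_oracles x qs y = return_pmf (map (\<lambda>q. pmf (q x) y) qs, map (\<lambda>q. Prob_Query q y) qs)"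
  by (induction qs) (simp_all add: pure_comp_def bind_comp_def prob_oracle_def bind_return_pmf)

text \<open>Given the sample \<open>y\<close>, the query log is the same whatever the rule decides,
  so the oracle counts can be read off.\<close>

lemma iteration_eq:
  "iteration rule p qs k x = bind_pmf (p x) (\<lambda>y.
     map_pmf (\<lambda>a. (if a then Some y else None,
         Sample_Query p # Prob_Query p y # map (\<lambda>q. Prob_Query q y) qs))
       (rule k (pmf (p x) y) (map (\<lambda>q. pmf (q x) y) qs)))"
  by (simp add: iteration_def prob_oracles_eq pure_comp_def bind_comp_def sample_oracle_def
      prob_oracle_def map_pmf_def bind_return_pmf bind_assoc_pmf)

text \<open>The subprobability \<beta> of the overview: the query log is forgotten and
  \<open>None\<close>, meaning rejection, is the missing mass.\<close>

definition iteration_output where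
  "iteration_output rule p qs k x = map_pmf fst (iteration rule p qs k x)"

lemma acceptance_prob_eq:
  "acceptance_prob rule p qs k x = weight_spmf (iteration_output rule p qs k x)"
proof -
  have "{(r :: 'b option, l :: ('a \<Rightarrow> 'b pmf, 'b) query list). r \<noteq> None} = fst -` range Some"
    by auto
  then show ?thesis
    by (simp add: iteration_output_def acceptance_prob_def space_measure_spmf
        measure_measure_spmf_conv_measure_pmf)
qed

lemma spmf_iteration_output:
  "spmf (iteration_output rule p qs k x) y =
     pmf (p x) y * pmf (rule k (pmf (p x) y) (map (\<lambda>q. pmf (q x) y) qs)) True"
proof -
  let ?R = "\<lambda>z. rule k (pmf (p x) z) (map (\<lambda>q. pmf (q x) z) qs)"
  let ?f = "\<lambda>z. map_pmf (\<lambda>a. if a then Some z else None) (?R z)"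
  have "iteration_output rule p qs k x = bind_pmf (p x) ?f"
    by (simp add: iteration_output_def iteration_eq map_bind_pmf pmf.map_comp o_def)
  then have "spmf (iteration_output rule p qs k x) y = (\<integral>z. spmf (?f z) y \<partial>measure_pmf (p x))"
    by (simp add: pmf_bind)
  \<comment> \<open>Only the sample \<open>y\<close> itself can lead to the output
    \<open>Some y\<close>.\<close>
  also have "\<dots> = (\<Sum>z\<in>{y}. spmf (?f z) y * pmf (p x) z)"
    by (rule integral_measure_pmf_real) (auto simp: pmf_eq_0_set_pmf split: if_splits)
  also have "\<dots> = spmf (?f y) y * pmf (p x) y" by simp
  also have "spmf (?f y) y = pmf (?R y) True"
  proof -
    have "{b. b} = {True}" by auto
    then show ?thesis by (simp add: pmf_map vimage_def measure_pmf_single cong: if_cong)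
  qed
  finally show ?thesis by simp
qed

text \<open>For \<open>cp_rule\<close> the left side is \<open>0\<close> on rejection, and
  acceptance bounds \<open>a / b\<close> by \<open>2 powr k\<close>. For
  \<open>smooth_cp_rule\<close> the acceptance probability is a minimum with
  \<open>2 powr k * b / a\<close> among its candidates.\<close>

lemma rule_True_le:
  assumes "rule \<in> {cp_rule, smooth_cp_rule}" "a > 0" "\<And>b. b \<in> set bs \<Longrightarrow> b \<ge> 0" "b \<in> set bs"
  shows "a * pmf (rule k a bs) True \<le> 2 powr k * b"
proof (cases "rule = cp_rule")
  case True
  show ?thesis
  proof (cases "\<forall>b\<in>set bs. log2_ratio a b \<le> ereal k")
    case acc: True
    then have le: "log2_ratio a b \<le> ereal k" using assms by blast
    \<comment> \<open>For \<open>b = 0\<close> the ratio would be infinite, contradicting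
      acceptance.\<close>
    then have "b > 0" using assms(3)[OF assms(4)] by (auto simp: log2_ratio_def split: if_splits)
    with le assms have "a / b \<le> 2 powr k"
      by (simp add: log2_ratio_def log_le_iff)
    then have "a \<le> 2 powr k * b" using \<open>b > 0\<close> by (simp add: field_simps)
    moreover have "a * pmf (rule k a bs) True \<le> a" using assms by (simp add: mult_left_le pmf_le_1)
    ultimately show ?thesis by linarith
  next
    case False
    then have "rule k a bs = return_pmf False" using True by (simp only: cp_rule_def if_False)
    then show ?thesis using assms by simp
  qed
next
  case False
  let ?S = "insert 1 ((\<lambda>b. 2 powr k * b / a) ` set bs)"
  have rule: "rule k a bs = bernoulli_pmf (Min ?S)"
    using False assms(1) by (auto simp: smooth_cp_rule_def)
  have "0 \<le> Min ?S" using assms by (subst Min_ge_iff) auto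
  moreover have "Min ?S \<le> 1" by (rule Min_le) auto
  ultimately have "pmf (rule k a bs) True = Min ?S" by (simp only: rule pmf_bernoulli_True)
  also have "Min ?S \<le> 2 powr k * b / a" using assms by (intro Min_le) auto
  finally show ?thesis using assms by (simp add: field_simps)
qed

lemma run_eq: "run rule p qs k x = repeat_until (iteration_output rule p qs k x) 0"
  by (simp add: run_def iteration_output_def)

context
  fixes rule p qs k x w
  assumes w: "w = acceptance_prob rule p qs k x" and pos: "w > 0"
begin

lemma pmf_returned_model:
  "pmf (returned_model rule p qs k x) y = spmf (iteration_output rule p qs k x) y / w"
proof -
  let ?B = "iteration_output rule p qs k x"
  have wt: "weight_spmf ?B > 0" using pos by (simp add: w acceptance_prob_eq)
  \<comment> \<open>The first marginal of the product law.\<close>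
  have "returned_model rule p qs k x = accepted ?B"
    unfolding returned_model_def run_eq repeat_until_eq_geometric[OF wt]
    by (simp add: map_spmf_of_pmf map_fst_pair_pmf spmf_of_pmf_def pmf.map_comp o_def)
  then show ?thesis by (simp add: pmf_accepted[OF wt] w acceptance_prob_eq)
qed

lemma expected_iterations_eq: "expected_iterations rule p qs k x = ennreal (1 / w)"
proof -
  let ?B = "iteration_output rule p qs k x"
  have wt: "weight_spmf ?B > 0" using pos by (simp add: w acceptance_prob_eq)
  show ?thesis
    unfolding expected_iterations_def run_eq repeat_until_eq_geometric[OF wt]
    using nn_integral_Suc_geometric_pmf[OF wt weight_spmf_le_1]
    by (simp add: spmf_of_pmf_def nn_integral_pair_pmf' w acceptance_prob_eq del: of_nat_Suc)
qed

end

lemma log2_ratio_le_add_log2_ratio: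
  assumes "w > 0" "a > 0" "b > 0" "a \<le> 2 powr k * b"
  shows "log2_ratio (a / w) b \<le> ereal k + log2_ratio 1 w"
proof -
  have "a / w / b \<le> 2 powr k / w" using assms by (simp add: field_simps)
  then have "log 2 (a / w / b) \<le> log 2 (2 powr k / w)" using assms by simp
  also have "\<dots> = k + log 2 (1 / w)" using assms by (simp add: log_divide)
  finally show ?thesis using assms by (simp add: log2_ratio_def)
qed

theorem theorem3p5:
  "\<exists>c::real. c > 0 \<and>
    (\<forall>(\<C> :: 'c set) (safe :: 'c \<Rightarrow> ('x, 'y) model) (p :: ('x, 'y) model) V qs (k :: real) x
       rule pk \<nu>.
      rule \<in> {cp_rule, smooth_cp_rule} \<longrightarrow>
      is_cover V \<C> safe \<longrightarrow> set qs = V \<longrightarrow> distinct qs \<longrightarrow> k \<ge> 0 \<longrightarrow>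
      pk = returned_model rule p qs k \<longrightarrow>
      \<nu> = acceptance_prob rule p qs k x \<longrightarrow>
        (\<exists>kx. kx \<le> ereal k + log2_ratio 1 \<nu> \<and> near_access_free \<C> safe Delta_max kx pk x)
      \<and> TV (pk x) (p x) \<le> 1 - \<nu>
      \<and> expected_iterations rule p qs k x \<le> ennreal c * (1 / ennreal \<nu>)
      \<and> (\<forall>(r, l) \<in> set_pmf (iteration rule p qs k x).
            filter is_sample l = [Sample_Query p]
          \<and> length (filter is_prob l) = card V + 1
          \<and> (\<forall>u \<in> set l. is_prob u \<longrightarrow> queried u = p \<or> queried u \<in> V)))"
\<comment> \<open>The constant \<open>1\<close> works since the expected number of iterations is
  exactly \<open>1 / \<nu>\<close> when \<open>\<nu> > 0\<close>.\<close>
proof (rule exI[of _ 1], intro conjI allI impI)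
  fix \<C> :: "'c set" and safe :: "'c \<Rightarrow> ('x, 'y) model" and p :: "('x, 'y) model"
    and V qs and k :: real and x rule pk \<nu>
  assume rule: "rule \<in> {cp_rule, smooth_cp_rule}"
    and cover: "is_cover V \<C> safe" and qs: "set qs = V" "distinct qs"
    and pk: "pk = returned_model rule p qs k" and \<nu>: "\<nu> = acceptance_prob rule p qs k x"
  let ?B = "iteration_output rule p qs k x"
  have \<nu>01: "0 \<le> \<nu>" "\<nu> \<le> 1"
    by (simp_all add: \<nu> acceptance_prob_eq weight_spmf_le_1)
  have output_le: "spmf ?B y \<le> pmf (p x) y" for y
    by (simp add: spmf_iteration_output mult_left_le pmf_le_1)
  have pk_eq: "pmf (pk x) y = spmf ?B y / \<nu>" if "\<nu> > 0" for y
    unfolding pk by (rule pmf_returned_model[OF \<nu> that])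
  have Delta: "Delta_max (pk x) (q x) \<le> ereal k + log2_ratio 1 \<nu>" if q: "q \<in> V" for q
  proof (cases "\<nu> = 0")
    case True
    \<comment> \<open>Here \<open>log2_ratio 1 0\<close> is infinite, so the bound is
      trivial.\<close>
    then show ?thesis by (simp add: log2_ratio_def)
  next
    case False
    with \<nu>01 have pos: "\<nu> > 0" by simp
    show ?thesis
      unfolding Delta_max_def
    proof (rule SUP_least)
      fix y assume "y \<in> set_pmf (pk x)"
      then have "spmf ?B y > 0"
        using pk_eq[OF pos, of y] pos by (simp add: pmf_positive_iff[symmetric] zero_less_divide_iff)
      moreover have "spmf ?B y \<le> 2 powr k * pmf (q x) y"
        unfolding spmf_iteration_output
        using rule calculation output_le[of y] q qs by (intro rule_True_le) auto
      \<comment> \<open>A positive accepted mass below \<open>2 powr k * pmf (q x) y\<close> rules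
        out the infinite ratio.\<close>
      moreover have "pmf (q x) y > 0"
        using calculation by (metis mult_zero_right not_less pmf_pos pmf_nonneg)
      ultimately show "log2_ratio (pmf (pk x) y) (pmf (q x) y) \<le> ereal k + log2_ratio 1 \<nu>"
        using pos unfolding pk_eq[OF pos]
        by (intro log2_ratio_le_add_log2_ratio) auto
    qed
  qed
  with cover have "near_access_free \<C> safe Delta_max (ereal k + log2_ratio 1 \<nu>) pk x"
    unfolding near_access_free_def is_cover_def by blast
  then show "\<exists>kx. kx \<le> ereal k + log2_ratio 1 \<nu> \<and> near_access_free \<C> safe Delta_max kx pk x"
    by blast
  have "spmf ?B y \<le> pmf (pk x) y" for y
  proof (cases "\<nu> = 0")
    case True
    \<comment> \<open>Zero total weight forces every accepted mass to be \<open>0\<close>, whatever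
      the unspecified \<open>pk x\<close> is.\<close>
    then show ?thesis
      by (metis \<nu> acceptance_prob_eq order_trans pmf_nonneg spmf_le_weight)
  next
    case False
    with \<nu>01 show ?thesis by (simp add: pk_eq le_divide_eq mult_left_le)
  qed
  from TV_le_of_common_spmf[of ?B, OF this output_le] show "TV (pk x) (p x) \<le> 1 - \<nu>"
    by (simp add: \<nu> acceptance_prob_eq)
  show "expected_iterations rule p qs k x \<le> ennreal 1 * (1 / ennreal \<nu>)"
  proof (cases "\<nu> = 0")
    case False
    with \<nu>01 show ?thesis
      using expected_iterations_eq[OF \<nu>] by (simp add: divide_ennreal[symmetric])
  \<comment> \<open>For \<open>\<nu> = 0\<close> the right-hand side is infinite in
    \<open>ennreal\<close>.\<close>
  qed simp
  have "card V = length qs" using qs distinct_card by blast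
  then show "\<forall>(r, l) \<in> set_pmf (iteration rule p qs k x).
            filter is_sample l = [Sample_Query p]
          \<and> length (filter is_prob l) = card V + 1
          \<and> (\<forall>u \<in> set l. is_prob u \<longrightarrow> queried u = p \<or> queried u \<in> V)"
    using qs by (auto simp: iteration_eq filter_map o_def)
qed simp

end
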